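(* Let $T>0$, $F_0>0$, $K>0$, $\lambda<0$, and let $\sigma:\mathbb R\to(0,\infty)$ be a twice continuously differentiable smile function of log-moneyness. Let $f_{\mathrm{BS}}$ be either the Black-Scholes call price $C_{\mathrm{BS}}$ or put price $P_{\mathrm{BS}}$. Then at $F=F_0$ the option power delta is lower than the "powerless" total delta: $$\left.\frac{d}{dF}f_{\mathrm{BS}}\!\left(F,K,\sigma\!\left(\ln\tfrac KF\right)\left(\tfrac F{F_0}\right)^{\lambda}\right)\right|_{F=F_0}<\left.\frac{d}{dF}f_{\mathrm{BS}}\!\left(F,K,\sigma\!\left(\ln\tfrac KF\right)\right)\right|_{F=F_0},$$ where the powerless total delta is $$\frac{d}{dF}f_{\mathrm{BS}}\!\left(F,K,\sigma\!\left(\ln\tfrac KF\right)\right)=\frac{\partial f_{\mathrm{BS}}}{\partial F}-\frac1F\,\sigma'\!\left(\ln\tfrac KF\right)\frac{\partial f_{\mathrm{BS}}}{\partial\varsigma},$$ with the partial derivatives of $f_{\mathrm{BS}}(F,K,\varsigma)$ evaluated at $\big(F,K,\sigma(\ln\frac KF)\big)$.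
   Context: Let $N$ be the standard normal cumulative distribution function. The undiscounted Black-Scholes call and put prices to maturity $T>0$ with forward price $F>0$, strike $K>0$ and volatility $\varsigma>0$ are $$C_{\mathrm{BS}}(F,K,\varsigma)=FN(d_1)-KN(d_2),\qquad P_{\mathrm{BS}}(F,K,\varsigma)=KN(-d_2)-FN(-d_1),\qquad d_{1,2}=\frac{\ln(F/K)}{\varsigma\sqrt T}\pm\tfrac12\varsigma\sqrt T.$$ Given a smile $\sigma(x)$ depending only on log-moneyness $x=\ln(K/F)$, an initial forward price $F_0>0$ and a parameter $\lambda\in\mathbb R$, the power smile is $(x,F)\mapsto\sigma(x)(F/F_0)^{\lambda}$. The option power delta is the total derivative with respect to $F$ (at fixed $K$) of $f_{\mathrm{BS}}\big(F,K,\sigma(\ln\frac KF)(F/F_0)^\lambda\big)$. *)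

theory Defs
  imports "HOL-Probability.Probability"
begin

definition std_normal_cdf :: "real \<Rightarrow> real" where
  "std_normal_cdf = cdf std_normal_distribution"

text \<open>
  Undiscounted Black-Scholes prices, with arguments in the order
  maturity \<open>T\<close>, forward \<open>F\<close>, strike \<open>K\<close>, volatility \<open>v\<close>.
  They are meaningful only when all four arguments are positive.
\<close>

definition bs_d1 :: "real \<Rightarrow> real \<Rightarrow> real \<Rightarrow> real \<Rightarrow> real" where
  "bs_d1 T F K v = ln (F / K) / (v * sqrt T) + v * sqrt T / 2"

definition bs_d2 :: "real \<Rightarrow> real \<Rightarrow> real \<Rightarrow> real \<Rightarrow> real" where
  "bs_d2 T F K v = ln (F / K) / (v * sqrt T) - v * sqrt T / 2"

definition bs_call :: "real \<Rightarrow> real \<Rightarrow> real \<Rightarrow> real \<Rightarrow> real" where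
  "bs_call T F K v =
     F * std_normal_cdf (bs_d1 T F K v) - K * std_normal_cdf (bs_d2 T F K v)"

definition bs_put :: "real \<Rightarrow> real \<Rightarrow> real \<Rightarrow> real \<Rightarrow> real" where
  "bs_put T F K v =
     K * std_normal_cdf (- bs_d2 T F K v) - F * std_normal_cdf (- bs_d1 T F K v)"

definition power_smile ::
    "(real \<Rightarrow> real) \<Rightarrow> real \<Rightarrow> real \<Rightarrow> real \<Rightarrow> real \<Rightarrow> real" where
  "power_smile \<sigma> F0 l x F = \<sigma> x * (F / F0) powr l"

text \<open>
  In the two deltas the pricing function \<open>f\<close> takes forward, strike and volatility.
  Both are total derivatives in the forward: the log-moneyness \<open>ln (K / F)\<close> moves
  with the forward while the strike is kept fixed. The value of \<^const>\<open>deriv\<close> is only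
  meaningful where the derivative exists, which has to be claimed separately.
\<close>

definition option_power_delta ::
    "(real \<Rightarrow> real \<Rightarrow> real \<Rightarrow> real) \<Rightarrow> (real \<Rightarrow> real) \<Rightarrow> real \<Rightarrow> real \<Rightarrow> real \<Rightarrow> real \<Rightarrow> real"
  where
  "option_power_delta f \<sigma> F0 l K F =
     deriv (\<lambda>G. f G K (power_smile \<sigma> F0 l (ln (K / G)) G)) F"

definition powerless_delta ::
    "(real \<Rightarrow> real \<Rightarrow> real \<Rightarrow> real) \<Rightarrow> (real \<Rightarrow> real) \<Rightarrow> real \<Rightarrow> real \<Rightarrow> real" where
  "powerless_delta f \<sigma> K F = deriv (\<lambda>G. f G K (\<sigma> (ln (K / G)))) F"

definition twice_continuously_differentiable :: "(real \<Rightarrow> real) \<Rightarrow> bool" where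
  "twice_continuously_differentiable g \<longleftrightarrow>
     (\<forall>x. g differentiable (at x)) \<and>
     (\<forall>x. deriv g differentiable (at x)) \<and>
     continuous_on UNIV (deriv (deriv g))"

end

theory Submission
  imports Defs
begin

text \<open>
  The identity \<open>F * std_normal_density d1 = K * std_normal_density d2\<close> cancels the contributions of
  \<open>d1\<close> and \<open>d2\<close> to the derivative of a price along any smooth path of forward and volatility, except
  for the vega term \<open>F * std_normal_density d1 * sqrt T\<close> times the derivative of the volatility. So
  the two total deltas at \<open>F0\<close> differ only by vega, which is positive, times the difference of the
  derivatives of the two volatilities, which is \<open>\<sigma> (ln (K / F0)) * l / F0 < 0\<close>.
\<close>

text \<open>Near \<open>x\<close> the distribution function is a constant plus the integral of
  \<open>h\<close> from \<open>x - 1\<close>, so the fundamental theorem of calculus applies. The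
  base point \<open>x - 1\<close> puts \<open>x\<close> in the interior of the interval, which turns
  the derivative within the interval into a full one.\<close>

lemma cdf_density_lborel_has_real_derivative:
  fixes h :: "real \<Rightarrow> real"
  assumes prob: "prob_space (density lborel h)"
    and nonneg: "\<And>x. 0 \<le> h x" and cont: "continuous_on UNIV h"
  shows "(cdf (density lborel h) has_real_derivative h x) (at x)"
proof -
  let ?M = "density lborel h"
  interpret M: real_distribution ?M
    using prob by (simp add: real_distribution_def real_distribution_axioms_def)
  have meas: "h \<in> borel_measurable borel"
    using cont by (rule borel_measurable_continuous_onI)
  have diff: "cdf ?M y = cdf ?M (x - 1) + integral {x - 1..y} h" if y: "y \<in> {x - 1<..<x + 1}" for y
  proof -
    have int: "set_integrable lborel {x - 1..y} h"
      by (rule borel_integrable_atLeastAtMost') (rule continuous_on_subset[OF cont], simp)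
    have "cdf ?M y - cdf ?M (x - 1) = measure ?M {x - 1<..y}"
      using y by (intro M.cdf_diff_eq) auto
    also have "\<dots> = (LINT t|lborel. indicator {x - 1<..y} t * h t)"
      unfolding measure_def
      using meas nonneg
      by (subst emeasure_density)
         (auto simp: integral_eq_nn_integral ennreal_mult' mult.commute ennreal_indicator
               intro!: arg_cong[where f = enn2real] nn_integral_cong split: split_indicator)
    \<comment> \<open>Adding the endpoint \<open>x - 1\<close> changes the integrand on a null set
      only.\<close>
    also have "\<dots> = (LINT t|lborel. indicator {x - 1..y} t * h t)"
      using meas by (intro integral_cong_AE) (auto intro!: eventually_mono[OF AE_lborel_singleton[of "x - 1"]] split: split_indicator)
    also have "\<dots> = integral {x - 1..y} h"
      using set_borel_integral_eq_integral(2)[OF int] by (simp add: set_lebesgue_integral_def)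
    finally show ?thesis by simp
  qed
  have "((\<lambda>y. integral {x - 1..y} h) has_real_derivative h x) (at x within {x - 1..x + 1})"
    by (rule integral_has_real_derivative) (auto intro: continuous_on_subset[OF cont])
  then have "((\<lambda>y. integral {x - 1..y} h) has_real_derivative h x) (at x)"
    by (simp add: at_within_Icc_at)
  then have "((\<lambda>y. cdf ?M (x - 1) + integral {x - 1..y} h) has_real_derivative h x) (at x)"
    by (auto intro!: derivative_eq_intros)
  then show ?thesis
    by (rule has_field_derivative_transform_within_open[of _ _ _ "{x - 1<..<x + 1}"])
       (auto simp: diff)
qed

lemma std_normal_cdf_has_real_derivative:
  "(std_normal_cdf has_real_derivative std_normal_density x) (at x)"
  unfolding std_normal_cdf_def
proof (rule cdf_density_lborel_has_real_derivative)
  show "continuous_on UNIV std_normal_density"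
    unfolding normal_density_def by (intro continuous_intros) auto
qed (simp_all add: prob_space_normal_density)

lemmas std_normal_cdf_has_real_derivative_chain [derivative_intros] =
  DERIV_chain2[OF std_normal_cdf_has_real_derivative]

lemma std_normal_density_minus: "std_normal_density (- x) = std_normal_density x"
  by (simp add: std_normal_density_def)

text \<open>The squares of \<open>d1\<close> and \<open>d2\<close> differ by twice the product of
  the two summands in \<open>d1\<close>, that is by \<open>2 * ln (F / K)\<close>. Hence the
  exponentials in the two densities have ratio \<open>F / K\<close>.\<close>

lemma forward_density_d1_eq_strike_density_d2:
  assumes "T > 0" "F > 0" "K > 0" "v > 0"
  shows "F * std_normal_density (bs_d1 T F K v) = K * std_normal_density (bs_d2 T F K v)"
proof -
  let ?u = "v * sqrt T"
  have u: "?u \<noteq> 0" using assms by simp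
  have "(a / ?u + ?u / 2)\<^sup>2 - (a / ?u - ?u / 2)\<^sup>2 = 2 * a" for a
    using u by (simp add: power2_eq_square field_simps)
  from this[of "ln (F / K)"] have "- (bs_d2 T F K v)\<^sup>2 / 2 = ln (F / K) + - (bs_d1 T F K v)\<^sup>2 / 2"
    unfolding bs_d1_def bs_d2_def by linarith
  then have "exp (- (bs_d2 T F K v)\<^sup>2 / 2) = F / K * exp (- (bs_d1 T F K v)\<^sup>2 / 2)"
    using assms by (simp only: exp_add exp_ln divide_pos_pos)
  then show ?thesis
    using assms by (simp add: std_normal_density_def)
qed

context
  fixes T K t :: real and g v :: "real \<Rightarrow> real" and g' v' :: real
  assumes pos: "T > 0" "K > 0" "g t > 0" "v t > 0"
    and g: "(g has_real_derivative g') (at t)" and v: "(v has_real_derivative v') (at t)"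
begin

text \<open>Since \<open>d1 - d2 = v * sqrt T\<close>, the two derivatives differ by
  \<open>sqrt T * v'\<close>. The common part \<open>D\<close> stays abstract because it cancels in
  both prices.\<close>

lemma bs_d1_d2_path_derivatives:
  obtains D where
    "((\<lambda>s. bs_d1 T (g s) K (v s)) has_real_derivative D + sqrt T * v') (at t)"
    "((\<lambda>s. bs_d2 T (g s) K (v s)) has_real_derivative D) (at t)"
proof -
  \<comment> \<open>Quotient rule for the summand shared by \<open>d1\<close> and \<open>d2\<close>,
    with \<open>g' / g t\<close> as the derivative of \<open>ln (g s / K)\<close>.\<close>
  define E where "E = (g' / g t * (v t * sqrt T) - ln (g t / K) * (v' * sqrt T)) / (v t * sqrt T)\<^sup>2"
  have "((\<lambda>s. ln (g s / K) / (v s * sqrt T)) has_real_derivative E) (at t)"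
    unfolding E_def using pos
    by (auto intro!: derivative_eq_intros g v simp: power2_eq_square)
  moreover have "((\<lambda>s. v s * sqrt T / 2) has_real_derivative v' * sqrt T / 2) (at t)"
    by (intro DERIV_cdivide DERIV_cmult_right v)
  ultimately have "((\<lambda>s. bs_d1 T (g s) K (v s)) has_real_derivative E + v' * sqrt T / 2) (at t)"
    and "((\<lambda>s. bs_d2 T (g s) K (v s)) has_real_derivative E - v' * sqrt T / 2) (at t)"
    unfolding bs_d1_def bs_d2_def by (rule DERIV_add DERIV_diff; assumption)+
  then show ?thesis
    by (intro that[of "E - v' * sqrt T / 2"]) (simp_all add: algebra_simps)
qed

text \<open>Moving forward and volatility together lets one formula serve for the total deltas, for
  the partial delta (\<open>v\<close> constant) and for vega (\<open>g\<close> constant).\<close>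

lemma bs_call_path_derivative:
  "((\<lambda>s. bs_call T (g s) K (v s)) has_real_derivative
      std_normal_cdf (bs_d1 T (g t) K (v t)) * g'
      + g t * std_normal_density (bs_d1 T (g t) K (v t)) * sqrt T * v') (at t)"
proof -
  obtain D where D:
    "((\<lambda>s. bs_d1 T (g s) K (v s)) has_real_derivative D + sqrt T * v') (at t)"
    "((\<lambda>s. bs_d2 T (g s) K (v s)) has_real_derivative D) (at t)"
    by (rule bs_d1_d2_path_derivatives)
  show ?thesis
    unfolding bs_call_def
    by (rule derivative_eq_intros g D refl)+
       (use forward_density_d1_eq_strike_density_d2[OF pos(1,3,2,4)] in \<open>simp add: algebra_simps\<close>)
qed

text \<open>The density is even, so the signs in front of \<open>d1\<close> and \<open>d2\<close>
  cancel against those of the put formula and leave the same vega as for the call.\<close>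

lemma bs_put_path_derivative:
  "((\<lambda>s. bs_put T (g s) K (v s)) has_real_derivative
      - std_normal_cdf (- bs_d1 T (g t) K (v t)) * g'
      + g t * std_normal_density (bs_d1 T (g t) K (v t)) * sqrt T * v') (at t)"
proof -
  obtain D where D:
    "((\<lambda>s. bs_d1 T (g s) K (v s)) has_real_derivative D + sqrt T * v') (at t)"
    "((\<lambda>s. bs_d2 T (g s) K (v s)) has_real_derivative D) (at t)"
    by (rule bs_d1_d2_path_derivatives)
  show ?thesis
    unfolding bs_put_def
    by (rule derivative_eq_intros g D refl)+
       (use forward_density_d1_eq_strike_density_d2[OF pos(1,3,2,4)] in
         \<open>simp add: algebra_simps std_normal_density_minus\<close>)
qed

end

theorem corollary3p2:
  fixes T F0 K l :: real
    and \<sigma> :: "real \<Rightarrow> real"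
    and f :: "real \<Rightarrow> real \<Rightarrow> real \<Rightarrow> real"
  assumes "T > 0" and "F0 > 0" and "K > 0" and "l < 0"
    and "\<And>x. \<sigma> x > 0"
    and "twice_continuously_differentiable \<sigma>"
    and "f = bs_call T \<or> f = bs_put T"
  shows "(\<lambda>G. f G K (power_smile \<sigma> F0 l (ln (K / G)) G)) differentiable (at F0)
    \<and> option_power_delta f \<sigma> F0 l K F0 < powerless_delta f \<sigma> K F0
    \<and> (\<forall>F>0.
          (\<lambda>G. f G K (\<sigma> (ln (K / G)))) differentiable (at F)
        \<and> (\<lambda>G. f G K (\<sigma> (ln (K / F)))) differentiable (at F)
        \<and> (\<lambda>v. f F K v) differentiable (at (\<sigma> (ln (K / F))))
        \<and> powerless_delta f \<sigma> K F
            = deriv (\<lambda>G. f G K (\<sigma> (ln (K / F)))) F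
              - 1 / F * deriv \<sigma> (ln (K / F)) * deriv (\<lambda>v. f F K v) (\<sigma> (ln (K / F))))"
proof -
  define V where "V F v = F * std_normal_density (bs_d1 T F K v) * sqrt T" for F v
  \<comment> \<open>Call and put differ only in the coefficient \<open>\<Delta>\<close> of the
    forward. As \<open>V\<close> is common to both, the rest of the proof needs no case
    distinction.\<close>
  obtain \<Delta> where path: "((\<lambda>s. f (g s) K (v s)) has_real_derivative
        \<Delta> (g t) (v t) * g' + V (g t) (v t) * v') (at t)"
    if "g t > 0" "v t > 0" "(g has_real_derivative g') (at t)" "(v has_real_derivative v') (at t)"
    for g v g' v' t
  proof (cases "f = bs_call T")
    case True
    show ?thesis
      by (rule that[of "\<lambda>F v. std_normal_cdf (bs_d1 T F K v)"])
         (use bs_call_path_derivative \<open>T > 0\<close> \<open>K > 0\<close> in \<open>simp add: True V_def\<close>)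
  next
    case False
    then have put: "f = bs_put T" using assms(7) by simp
    show ?thesis
      by (rule that[of "\<lambda>F v. - std_normal_cdf (- bs_d1 T F K v)"])
         (use bs_put_path_derivative \<open>T > 0\<close> \<open>K > 0\<close> in \<open>simp add: put V_def\<close>)
  qed
  have V_pos: "V F v > 0" if "F > 0" for F v
    using that \<open>T > 0\<close> by (simp add: V_def normal_density_pos)
  have \<sigma>: "(\<sigma> has_real_derivative deriv \<sigma> x) (at x)" for x
    using assms(6) by (simp add: twice_continuously_differentiable_def DERIV_deriv_iff_real_differentiable)
  have smile: "((\<lambda>G. \<sigma> (ln (K / G))) has_real_derivative - (deriv \<sigma> (ln (K / F)) / F)) (at F)"
    if "F > 0" for F
  proof -
    have "((\<lambda>G. ln (K / G)) has_real_derivative - (1 / F)) (at F)"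
      using that \<open>K > 0\<close> by (auto intro!: derivative_eq_intros simp: field_simps)
    from DERIV_chain2[OF \<sigma> this] show ?thesis by simp
  qed
  have powerless: "((\<lambda>G. f G K (\<sigma> (ln (K / G)))) has_real_derivative
      \<Delta> F (\<sigma> (ln (K / F))) - V F (\<sigma> (ln (K / F))) * (deriv \<sigma> (ln (K / F)) / F)) (at F)"
    if "F > 0" for F
    using path[OF _ _ DERIV_ident smile[OF that]] that assms(5) by simp
  \<comment> \<open>The two partial derivatives come from \<open>path\<close> by freezing the
    volatility here and the forward in \<open>vega\<close>.\<close>
  have delta: "((\<lambda>G. f G K (\<sigma> (ln (K / F)))) has_real_derivative \<Delta> F (\<sigma> (ln (K / F)))) (at F)"
    if "F > 0" for F
    using path[OF _ _ DERIV_ident DERIV_const, of F "\<sigma> (ln (K / F))"] that assms(5) by simp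
  have vega: "((\<lambda>v. f F K v) has_real_derivative V F (\<sigma> (ln (K / F)))) (at (\<sigma> (ln (K / F))))"
    if "F > 0" for F
    using path[OF _ _ DERIV_const DERIV_ident, of F] that assms(5) by simp
  \<comment> \<open>At \<open>F0\<close> the power factor equals 1 and has derivative
    \<open>l / F0\<close>. So volatility and smile slope are those of the powerless case, and the
    product rule adds only \<open>\<sigma> (ln (K / F0)) * l / F0\<close>.\<close>
  have "((\<lambda>G. power_smile \<sigma> F0 l (ln (K / G)) G) has_real_derivative
      - (deriv \<sigma> (ln (K / F0)) / F0) + \<sigma> (ln (K / F0)) * l / F0) (at F0)"
    unfolding power_smile_def using \<open>F0 > 0\<close>
    by (auto intro!: derivative_eq_intros smile)
  from path[OF _ _ DERIV_ident this]
  have power: "((\<lambda>G. f G K (power_smile \<sigma> F0 l (ln (K / G)) G)) has_real_derivative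
      \<Delta> F0 (\<sigma> (ln (K / F0))) + V F0 (\<sigma> (ln (K / F0)))
        * (- (deriv \<sigma> (ln (K / F0)) / F0) + \<sigma> (ln (K / F0)) * l / F0)) (at F0)"
    using \<open>F0 > 0\<close> assms(5) by (simp add: power_smile_def)
  have "V F0 (\<sigma> (ln (K / F0))) * (\<sigma> (ln (K / F0)) * l / F0) < 0"
    using V_pos assms(2,4,5) by (intro mult_pos_neg divide_neg_pos) auto
  then have "option_power_delta f \<sigma> F0 l K F0 < powerless_delta f \<sigma> K F0"
    unfolding option_power_delta_def powerless_delta_def
      DERIV_imp_deriv[OF power] DERIV_imp_deriv[OF powerless[OF \<open>F0 > 0\<close>]]
    by (simp add: algebra_simps)
  moreover have "powerless_delta f \<sigma> K F = deriv (\<lambda>G. f G K (\<sigma> (ln (K / F)))) F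
      - 1 / F * deriv \<sigma> (ln (K / F)) * deriv (\<lambda>v. f F K v) (\<sigma> (ln (K / F)))" if "F > 0" for F
    unfolding powerless_delta_def DERIV_imp_deriv[OF powerless[OF that]]
      DERIV_imp_deriv[OF delta[OF that]] DERIV_imp_deriv[OF vega[OF that]]
    by simp
  ultimately show ?thesis
    using power powerless delta vega unfolding real_differentiable_def by blast
qed

end
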